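(* Let $p$ be a prime with $p \equiv 1 \pmod 3$, let $q = p^{p-1}$, and let $E/\mathbb{F}_p$ be the elliptic curve $y^2 = x^3 - 1$. If $p^2 = 3n^2 + 3n + 1$ for some $n \in \mathbb{Z}$, then $\#E(\mathbb{F}_q) \equiv 0 \pmod{p^2}$. *)

theory Defs
  imports
    "HOL-Number_Theory.Number_Theory"
    "Berlekamp_Zassenhaus.Finite_Field"
begin

(* The Weierstrass equation y^2 + a1 x y + a3 y = x^3 + a2 x^2 + a4 x + a6. *)
datatype 'a weierstrass =
  Weierstrass (a1: 'a) (a2: 'a) (a3: 'a) (a4: 'a) (a6: 'a)

definition discriminant :: "'a::comm_ring_1 weierstrass \<Rightarrow> 'a" where
  "discriminant E =
    (let b2 = (a1 E)^2 + 4 * a2 E;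
         b4 = 2 * a4 E + a1 E * a3 E;
         b6 = (a3 E)^2 + 4 * a6 E;
         b8 = (a1 E)^2 * a6 E + 4 * a2 E * a6 E - a1 E * a3 E * a4 E
                + a2 E * (a3 E)^2 - (a4 E)^2
     in - (b2^2 * b8) - 8 * b4^3 - 27 * b6^2 + 9 * b2 * b4 * b6)"

definition elliptic_curve :: "'a::field weierstrass \<Rightarrow> bool" where
  "elliptic_curve E \<longleftrightarrow> discriminant E \<noteq> 0"

definition base_change :: "('a \<Rightarrow> 'b) \<Rightarrow> 'a weierstrass \<Rightarrow> 'b weierstrass" where
  "base_change h E = Weierstrass (h (a1 E)) (h (a2 E)) (h (a3 E)) (h (a4 E)) (h (a6 E))"

(* Points of the projective curve: the affine solutions and the single point [0:1:0] at infinity. *)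
datatype 'a point = Infinity | Affine 'a 'a

definition points :: "'a::field weierstrass \<Rightarrow> 'a point set" where
  "points E = insert Infinity
    {Affine x y | x y.
       y^2 + a1 E * x * y + a3 E * y = x^3 + a2 E * x^2 + a4 E * x + a6 E}"

lemma points_base_change_Mordell:
  assumes "field_hom h"
  shows "points (base_change h (Weierstrass 0 0 0 0 (- 1))) =
    insert Infinity {Affine x y | x y. y^2 = x^3 - 1}"
proof -
  interpret field_hom h by (rule assms)
  show ?thesis by (simp add: points_def base_change_def hom_distribs)
qed

lemma finite_points:
  fixes E :: "'a::finite_field weierstrass"
  shows "finite (points E)"
proof -
  have "points E \<subseteq> insert Infinity ((\<lambda>(x, y). Affine x y) ` UNIV)"
    by (auto simp: points_def)
  thus ?thesis by (rule finite_subset) simp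
qed

lemma elliptic_curve_Mordell:
  assumes "prime p" "[p = 1] (mod 3)" "CARD('k::finite_field) = p"
  shows "elliptic_curve (Weierstrass 0 0 0 0 (- 1) :: 'k weierstrass)"
proof -
  have "CHAR('k) dvd CARD('k)"
    by (rule CHAR_dvd_CARD)
  hence char: "CHAR('k) = p"
    using assms prime_CHAR_semidom[where ?'a='k] finite_imp_CHAR_pos[where ?'a='k]
    by (simp add: primes_dvd_imp_eq)
  have "p \<noteq> 2" "p \<noteq> 3"
    using assms(2) by (auto simp: cong_def)
  have "prime (2::nat)" "prime (3::nat)"
    by simp_all
  hence "\<not> p dvd 2" "\<not> p dvd 3"
    using assms(1) \<open>p \<noteq> 2\<close> \<open>p \<noteq> 3\<close> primes_dvd_imp_eq by blast+
  hence "\<not> p dvd 2^4 * 3^3"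
    using assms(1) by (metis prime_dvd_mult_iff prime_dvd_power)
  hence "of_nat (2^4 * 3^3) \<noteq> (0::'k)"
    by (metis char of_nat_eq_0_iff_char_dvd)
  thus ?thesis
    by (simp add: elliptic_curve_def discriminant_def)
qed

end

theory Submission
  imports Defs
begin

text \<open>
  Let \<open>T\<close> be the sum of the quadratic character of \<open>x^3 - 1\<close> over the field with \<open>q = p ^ (p - 1)\<close>
  elements. The curve has \<open>q + 1 + T\<close> points, and \<open>p^2\<close> divides \<open>q\<close>, so the claim is that \<open>T\<close> is
  \<open>-1\<close> modulo \<open>p^2\<close>.

  The curve has complex multiplication by the Eisenstein integers, so \<open>T\<close> should be, up to sign, the trace of an
  Eisenstein integer of norm \<open>q\<close>. The lemma \<open>cubic_char_sum_norm\<close> proves this directly, by computing the first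
  two moments of the character sums of the twists \<open>y^2 = x^3 + d\<close>: there is an integer \<open>b\<close> with
  \<open>T^2 + 3 * b^2 = 4 * q\<close>, so \<open>\<tau> = (T + b * sqrt (-3)) / 2\<close> has trace \<open>T\<close> and norm \<open>q\<close>.

  Modulo \<open>p\<close> the sum is, by Euler's criterion, minus the binomial coefficient of \<open>(q - 1) / 2\<close> over
  \<open>(q - 1) / 3\<close>. In base \<open>p\<close> both numbers consist of \<open>p - 1\<close> equal digits, so Lucas' congruence and Fermat's
  little theorem give \<open>T = -1\<close> modulo \<open>p\<close> (\<open>cubic_char_sum_cong_minus_1\<close>).

  The hypothesis on \<open>n\<close> lifts this to \<open>p^2\<close> (\<open>trace_cong_minus_1\<close>). It says that
  \<open>\<gamma> = (1 + (2 * n + 1) * sqrt (-3)) / 2\<close> has norm \<open>p^2\<close>. Since \<open>\<gamma>\<close> is not divisible by \<open>p\<close>, it is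
  a unit times the square of a prime above \<open>p\<close>; consequently \<open>\<tau>\<close>, which is not divisible
  by \<open>p\<close> either, is a unit times a power of \<open>\<gamma>\<close> or of its conjugate. As \<open>\<gamma>\<close> has trace \<open>1\<close>, all its
  positive powers have trace \<open>1\<close> modulo \<open>p^2\<close>. The congruence modulo \<open>p\<close> forces the
  unit to be \<open>-1\<close>, and so \<open>T = -1\<close> modulo \<open>p^2\<close>.
\<close>

section \<open>A binomial coefficient modulo a prime\<close>

text \<open>One step of Lucas' congruence. Each increment of \<open>a\<close> adds \<open>p\<close> to the upper index; in Vandermonde's
  convolution with the row \<open>p choose k\<close> only \<open>k = 0\<close> and \<open>k = p\<close> survive modulo \<open>p\<close>, which is
  Pascal's rule for the leading digits.\<close>
lemma lucas_congruence:
  fixes p a b c d :: nat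
  assumes "prime p" "b < p" "d < p"
  shows "[(p * a + b) choose (p * c + d) = (a choose c) * (b choose d)] (mod p)"
proof (induction a arbitrary: c)
  case 0
  show ?case
  proof (cases c)
    case (Suc c')
    hence "b < p * c + d" using assms(2) by (simp add: trans_less_add1)
    thus ?thesis using Suc by (simp add: binomial_eq_0)
  qed simp
next
  case (Suc a)
  define N where "N = p * a + b"
  define K where "K = p * c + d"
  have p: "p > 1" using assms(1) prime_gt_1_nat by blast
  let ?t = "\<lambda>k. (p choose k) * (N choose (K - k))"
  have "(p * Suc a + b) choose K = (p + N) choose K"
    by (simp add: N_def algebra_simps)
  also have "\<dots> = (\<Sum>k\<le>K. ?t k)" by (rule vandermonde [symmetric])
  finally have vand: "(p * Suc a + b) choose K = (\<Sum>k\<le>K. ?t k)" .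
  have "[(\<Sum>k\<le>K. ?t k) = (\<Sum>k\<le>K. if k \<in> {0, p} then ?t k else 0)] (mod p)"
  proof (rule cong_sum)
    fix k
    have "p dvd (p choose k)" if "k \<notin> {0, p}"
      using that assms(1) dvd_choose_prime[of k p] by (cases "k < p") (auto simp: binomial_eq_0)
    thus "[?t k = (if k \<in> {0, p} then ?t k else 0)] (mod p)"
      by (auto simp: cong_0_iff)
  qed
  also have "(\<Sum>k\<le>K. if k \<in> {0, p} then ?t k else 0) = (\<Sum>k\<in>{..K} \<inter> {0, p}. ?t k)"
    by (rule sum.inter_restrict [symmetric]) simp
  finally have red: "[(p * Suc a + b) choose K = (\<Sum>k\<in>{..K} \<inter> {0, p}. ?t k)] (mod p)"
    using vand by simp
  have "[(\<Sum>k\<in>{..K} \<inter> {0, p}. ?t k) = (Suc a choose c) * (b choose d)] (mod p)"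
  proof (cases c)
    case 0
    hence idx: "{..K} \<inter> {0, p} = {0}" using assms(3) by (auto simp: K_def)
    show ?thesis unfolding idx using Suc.IH[of 0] 0 by (simp add: N_def K_def)
  next
    case (Suc c')
    hence "{..K} \<inter> {0, p} = {0, p}" by (auto simp: K_def)
    hence "(\<Sum>k\<in>{..K} \<inter> {0, p}. ?t k) = (N choose K) + (N choose (p * c' + d))"
      using p Suc by (simp add: K_def)
    also have "[\<dots> = (a choose c) * (b choose d) + (a choose c') * (b choose d)] (mod p)"
      unfolding N_def K_def by (intro cong_add Suc.IH)
    also have "(a choose c) * (b choose d) + (a choose c') * (b choose d)
               = (Suc a choose c) * (b choose d)"
      using Suc by (simp add: algebra_simps)
    finally show ?thesis .
  qed
  with red show ?case unfolding K_def by (rule cong_trans)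
qed

text \<open>In base \<open>p\<close> the numbers \<open>(p ^ r - 1) / 2\<close> and \<open>(p ^ r - 1) / 3\<close> have \<open>r\<close> equal digits each, namely
  \<open>(p - 1) / 2\<close> and \<open>(p - 1) / 3\<close>. By Lucas the binomial coefficient is therefore an \<open>r\<close>-th power
  modulo \<open>p\<close>, and Fermat's little theorem applies when \<open>p - 1\<close> divides \<open>r\<close>.\<close>
lemma choose_half_third_cong_1:
  fixes p r :: nat
  assumes "prime p" "[p = 1] (mod 6)" "(p - 1) dvd r"
  shows "[((p ^ r - 1) div 2) choose ((p ^ r - 1) div 3) = 1] (mod p)"
proof -
  have mod6: "\<exists>s. m = 6 * s + 1" if "[m = 1] (mod 6)" for m :: nat
    using that by (intro exI[of _ "m div 6"]) (simp add: cong_def, presburger)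
  from mod6[OF assms(2)] obtain s where s: "p = 6 * s + 1" by blast
  define B where "B = (3 * s choose (2 * s))"
  have "[((p ^ r - 1) div 2) choose ((p ^ r - 1) div 3) = B ^ r] (mod p)" for r
  proof (induction r)
    case (Suc r)
    have "[p ^ r = 1 ^ r] (mod 6)" using assms(2) by (rule cong_pow)
    then obtain u where u: "p ^ r = 6 * u + 1" using mod6 by auto
    have "p ^ Suc r - 1 = 6 * (p * u + s)"
      using u s by (simp add: algebra_simps)
    hence "((p ^ Suc r - 1) div 2) choose ((p ^ Suc r - 1) div 3)
          = (p * (3 * u) + 3 * s) choose (p * (2 * u) + 2 * s)"
      by (simp add: algebra_simps)
    also have "[\<dots> = (3 * u choose (2 * u)) * B] (mod p)"
      unfolding B_def by (rule lucas_congruence) (use assms s in auto)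
    also have "3 * u choose (2 * u) = ((p ^ r - 1) div 2) choose ((p ^ r - 1) div 3)"
      using u by simp
    also have "[\<dots> * B = B ^ r * B] (mod p)"
      by (intro cong_mult Suc.IH cong_refl)
    finally show ?case by (simp add: mult.commute)
  qed simp
  note pow = this
  have "fact (2 * s) * fact s * B = (fact (3 * s) :: nat)"
    using binomial_fact_lemma[of "2 * s" "3 * s"] by (simp add: B_def)
  hence "B dvd fact (3 * s)" by (metis dvd_triv_right)
  moreover have "\<not> p dvd fact (3 * s)"
    using assms(1) s by (simp add: prime_dvd_fact_iff)
  ultimately have "\<not> p dvd B" using dvd_trans by blast
  hence ferm: "[B ^ (p - 1) = 1] (mod p)" using assms(1) fermat_theorem by blast
  obtain t where "r = (p - 1) * t" using assms(3) by blast
  hence "[B ^ r = 1] (mod p)"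
    using cong_pow[OF ferm, of t] by (simp add: power_mult)
  with pow[of r] show ?thesis by (rule cong_trans)
qed

section \<open>Eisenstein integers of norm a power of \<open>p^2\<close>\<close>

text \<open>\<open>(A + B * sqrt (-3)) / 2\<close> is the \<open>k\<close>-th power of \<open>\<gamma> = (1 + (2 * n + 1) * sqrt (-3)) / 2\<close>. This
  \<open>\<gamma>\<close> has trace \<open>1\<close>, and norm \<open>p^2\<close> by the hypothesis on \<open>n\<close>, so \<open>\<gamma>^2 = \<gamma> - p^2\<close>: modulo \<open>p^2\<close> it is
  idempotent, and all its positive powers agree with it. The parity condition says that the power is again
  an algebraic integer.\<close>
lemma powers_of_trace_one_element:
  fixes p n :: int and k :: nat
  assumes "p^2 = 3 * n^2 + 3 * n + 1" "k > 0"
  shows "\<exists>A B. A^2 + 3 * B^2 = 4 * (p^2)^k \<and> even (A + B) \<and>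
           [A = 1] (mod p^2) \<and> [B = 2 * n + 1] (mod p^2)"
  using assms(2)
proof (induction k rule: nat_induct_non_zero)
  case 1
  have "1 + 3 * (2 * n + 1)^2 = 4 * p^2"
    unfolding assms(1) by (simp add: power2_eq_square algebra_simps)
  thus ?case by (intro exI[of _ 1] exI[of _ "2 * n + 1"]) simp
next
  case (Suc k)
  then obtain A B where AB: "A^2 + 3 * B^2 = 4 * (p^2)^k" "even (A + B)"
    "p^2 dvd A - 1" "p^2 dvd B - (2 * n + 1)"
    by (auto simp: cong_iff_dvd_diff)
  from AB(2) obtain e where "A + B = 2 * e" by (rule evenE)
  hence e: "A = 2 * e - B" by simp
  \<comment> \<open>Coordinates of the product with \<open>\<gamma>\<close>; the parity of \<open>A + B\<close> allows the division by \<open>2\<close>.\<close>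
  define A' where "A' = e - B * (2 + 3 * n)"
  define B' where "B' = e * (2 * n + 1) - B * n"
  have A': "2 * A' = A - 3 * (2 * n + 1) * B" and B': "2 * B' = B + (2 * n + 1) * A"
    by (simp_all add: A'_def B'_def e algebra_simps)
  have "4 * (A'^2 + 3 * B'^2) = (2 * A')^2 + 3 * (2 * B')^2" by (simp add: power2_eq_square)
  also have "\<dots> = (1 + 3 * (2 * n + 1)^2) * (A^2 + 3 * B^2)"
    unfolding A' B' by (simp add: power2_eq_square algebra_simps)
  also have "1 + 3 * (2 * n + 1)^2 = 4 * p^2"
    using assms(1) by (simp add: power2_eq_square algebra_simps)
  finally have norm: "A'^2 + 3 * B'^2 = 4 * (p^2)^Suc k" using AB(1) by simp
  have "A' + B' = 2 * (e * (n + 1) - B * (2 * n + 1))"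
    by (simp add: A'_def B'_def algebra_simps)
  hence par: "even (A' + B')" by simp
  have "odd (p^2)" using assms(1) by (simp add: power2_eq_square)
  hence cop: "coprime (p^2) 2" by simp
  have "2 * (A' - 1) = (A - 1) - 3 * (2 * n + 1) * (B - (2 * n + 1)) - p^2 * 4"
    unfolding assms(1) right_diff_distrib A' by (simp add: power2_eq_square algebra_simps)
  moreover have "p^2 dvd (A - 1) - 3 * (2 * n + 1) * (B - (2 * n + 1)) - p^2 * 4"
    by (intro dvd_diff dvd_mult AB(3,4) dvd_triv_left)
  ultimately have "p^2 dvd 2 * (A' - 1)" by (simp only:)
  hence dA: "p^2 dvd A' - 1" using cop coprime_dvd_mult_right_iff by blast
  have "2 * (B' - (2 * n + 1)) = (B - (2 * n + 1)) + (2 * n + 1) * (A - 1)"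
    unfolding right_diff_distrib B' by (simp add: algebra_simps)
  moreover have "p^2 dvd (B - (2 * n + 1)) + (2 * n + 1) * (A - 1)"
    by (intro dvd_add dvd_mult AB(3,4))
  ultimately have "p^2 dvd 2 * (B' - (2 * n + 1))" by (simp only:)
  hence dB: "p^2 dvd B' - (2 * n + 1)" using cop coprime_dvd_mult_right_iff by blast
  show ?case using norm par dA dB by (auto simp: cong_iff_dvd_diff)
qed

text \<open>The solutions of \<open>X^2 + 3 * Y^2 = 16\<close> are, up to the factor \<open>4\<close>, the six units
  \<open>(X + Y * sqrt (-3)) / 4\<close> of the Eisenstein integers. The divisibility singles out the unit \<open>-1\<close>.\<close>
lemma eisenstein_unit_minus_1:
  fixes p X Y :: int
  assumes p: "prime p" "p > 3" and XY: "X^2 + 3 * Y^2 = 16" and pX: "p dvd X + 4"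
  shows "X = -4"
proof -
  have "X^2 \<le> 16" using XY zero_le_power2[of Y] by linarith
  hence "X^2 \<le> 4^2" by simp
  hence "\<bar>X\<bar> \<le> 4" using abs_le_square_iff[of X 4] by simp
  hence "X \<in> {-4..4}" by (simp add: abs_le_iff)
  hence X: "X \<in> {-4, -3, -2, -1, 0, 1, 2, 3, 4}"
    unfolding set_upto [symmetric] by (simp del: set_upto add: upto.simps)
  have "\<not> 9 \<le> Y^2" using XY zero_le_power2[of X] by linarith
  hence "\<not> 3^2 \<le> Y^2" by simp
  hence "\<not> 3 \<le> \<bar>Y\<bar>" using abs_le_square_iff[of 3 Y] by simp
  hence "Y \<in> {-2..2}" by (simp add: not_le abs_less_iff)
  hence Y: "Y \<in> {-2, -1, 0, 1, 2}"
    unfolding set_upto [symmetric] by (simp del: set_upto add: upto.simps)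
  have "X \<in> {-4, -2, 2, 4}" using X Y XY by auto
  moreover have "\<not> p dvd 2" "\<not> p dvd 3" using p(2) zdvd_imp_le[of p 2] zdvd_imp_le[of p 3] by auto
  hence "\<not> p dvd 2" "\<not> p dvd 2 * 3" "\<not> p dvd 2 ^ 3"
    using p(1) prime_dvd_mult_iff prime_dvd_power by blast+
  ultimately show ?thesis using pX by auto
qed

text \<open>Let \<open>\<tau> = (T + b * sqrt (-3)) / 2\<close>, of norm \<open>q = p ^ (2 * k)\<close>, and let \<open>\<gamma>\<close> be the element of trace
  \<open>1\<close> and norm \<open>p^2\<close>. Neither \<open>\<tau>\<close> nor \<open>\<gamma> ^ k\<close> is divisible by \<open>p\<close>, so by unique factorisation \<open>\<tau>\<close>
  is a unit times \<open>\<gamma> ^ k\<close> or its conjugate. Modulo \<open>p^2\<close> the powers of \<open>\<gamma>\<close> are known, hence so is \<open>T\<close> up to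
  that unit, and the value of \<open>T\<close> modulo \<open>p\<close> identifies the unit as \<open>-1\<close>. The proof computes with
  coordinates: \<open>(X + Y * sqrt (-3)) / 4\<close> is the unit.\<close>
lemma trace_cong_minus_1:
  fixes p n T b :: int and k :: nat
  assumes p: "prime p" "p > 3" and pn: "p^2 = 3 * n^2 + 3 * n + 1" and k: "k > 0"
    and norm: "T^2 + 3 * b^2 = 4 * (p^2)^k" and T: "[T = -1] (mod p)"
  shows "[T = -1] (mod p^2)"
proof -
  define c where "c = 2 * n + 1"
  define q where "q = (p^2)^k"
  have c: "3 * c^2 = 4 * p^2 - 1" unfolding c_def pn by (simp add: power2_eq_square algebra_simps)
  obtain A B where AB: "A^2 + 3 * B^2 = 4 * q" "p^2 dvd A - 1" "p^2 dvd B - c"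
    using powers_of_trace_one_element[OF pn k] by (auto simp: cong_iff_dvd_diff c_def q_def)
  have q0: "q > 0" using p by (simp add: q_def)
  have small: "\<not> p dvd m" if "m > 0" "m \<le> 3" for m
    using that p(2) zdvd_imp_le[of p m] by auto
  have pp: "p dvd p^2" by simp
  have pq: "p dvd q" using k by (auto simp: q_def power_mult [symmetric] intro: dvd_power)
  have "p dvd A - 1" using pp AB(2) by (rule dvd_trans)
  hence "\<not> p dvd A" using small[of 1] dvd_diff[of p A "A - 1"] by auto
  moreover have "\<not> p dvd b"
  proof
    assume "p dvd b"
    hence "p dvd 3 * b^2" by (simp add: power2_eq_square)
    moreover have "p dvd T^2 + 3 * b^2" using pq norm by (simp add: q_def)
    ultimately have "p dvd T^2" by (simp add: dvd_add_left_iff)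
    hence "p dvd T" using p(1) prime_dvd_power by blast
    moreover have "p dvd T + 1" using T by (simp add: cong_iff_dvd_diff)
    ultimately show False using small[of 1] by (simp add: dvd_add_right_iff)
  qed
  ultimately have two: "\<not> p dvd 2 * (b * A)" using small[of 2] p(1) by (auto simp: prime_dvd_mult_iff)
  have prod: "(b * A - T * B) * (b * A + T * B) = 4 * q * (b^2 - B^2)"
  proof -
    have "(b * A - T * B) * (b * A + T * B) = b^2 * (A^2 + 3 * B^2) - B^2 * (T^2 + 3 * b^2)"
      by (simp add: power2_eq_square algebra_simps)
    thus ?thesis using AB(1) norm by (simp add: q_def algebra_simps)
  qed
  hence qprod: "q dvd (b * A - T * B) * (b * A + T * B)" by simp
  have "q dvd b * A - T * B \<or> q dvd b * A + T * B"
  proof (cases "p dvd b * A - T * B")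
    case True
    hence "\<not> p dvd b * A + T * B"
      using two dvd_add[of p "b * A - T * B" "b * A + T * B"] by (auto simp: algebra_simps)
    hence "coprime q (b * A + T * B)"
      using p(1) by (simp add: q_def prime_imp_coprime)
    thus ?thesis using qprod by (simp add: coprime_dvd_mult_left_iff)
  next
    case False
    hence "coprime q (b * A - T * B)"
      using p(1) by (simp add: q_def prime_imp_coprime)
    thus ?thesis using qprod by (simp add: coprime_dvd_mult_right_iff)
  qed
  \<comment> \<open>The sign of \<open>b\<close> decides between \<open>\<gamma> ^ k\<close> and its conjugate.\<close>
  then obtain b' where b': "b'^2 = b^2" "q dvd b' * A - T * B"
  proof
    assume "q dvd b * A + T * B"
    hence "q dvd - (b * A + T * B)" by (simp only: dvd_minus_iff)
    hence "q dvd (- b) * A - T * B" by simp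
    thus ?thesis using that[of "-b"] by simp
  qed (use that in blast)
  then obtain Y where Y: "b' * A - T * B = q * Y" by blast
  \<comment> \<open>Multiplicativity of the norm for \<open>\<tau>\<close> times the conjugate of \<open>\<gamma> ^ k\<close>.\<close>
  have id: "(T * A + 3 * b' * B)^2 + 3 * (b' * A - T * B)^2 = 16 * q^2"
  proof -
    have "(T * A + 3 * b' * B)^2 + 3 * (b' * A - T * B)^2 = (T^2 + 3 * b'^2) * (A^2 + 3 * B^2)"
      by (simp add: power2_eq_square algebra_simps)
    thus ?thesis using AB(1) norm b'(1) by (simp add: q_def power2_eq_square)
  qed
  hence "(T * A + 3 * b' * B)^2 = q^2 * (16 - 3 * Y^2)"
    unfolding Y by (simp add: power_mult_distrib algebra_simps)
  hence "q^2 dvd (T * A + 3 * b' * B)^2" by simp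
  then obtain X where X: "T * A + 3 * b' * B = q * X" by (auto simp: pow_divides_pow_iff)
  have "q^2 * (X^2 + 3 * Y^2) = q^2 * 16"
    using id unfolding X Y by (simp add: power_mult_distrib algebra_simps)
  hence XY: "X^2 + 3 * Y^2 = 16" using q0 by simp
  have "q * (X * A - 3 * Y * B) = A * (q * X) - 3 * B * (q * Y)" by (simp add: algebra_simps)
  also have "\<dots> = T * (A^2 + 3 * B^2)"
    unfolding X[symmetric] Y[symmetric] by (simp add: power2_eq_square algebra_simps)
  also have "\<dots> = q * (4 * T)" using AB(1) by simp
  finally have T4: "X * A - 3 * Y * B = 4 * T" using q0 by simp
  have "4 * T - X + 3 * Y * c = X * (A - 1) - 3 * Y * (B - c)"
    using T4 by (simp add: algebra_simps)
  hence T4': "p^2 dvd 4 * T - X + 3 * Y * c" using AB(2,3) by simp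
  hence "p dvd 4 * T - X + 3 * Y * c" using pp dvd_trans by blast
  moreover have "p dvd T + 1" using T by (simp add: cong_iff_dvd_diff)
  ultimately have "p dvd 4 * (T + 1) - (4 * T - X + 3 * Y * c)" by (intro dvd_diff dvd_mult)
  hence "p dvd X + 4 - 3 * Y * c" by (simp add: algebra_simps)
  \<comment> \<open>Eliminating \<open>Y\<close> and \<open>c\<close> by multiplying with the conjugate factor, as \<open>3 * c^2\<close> is \<open>-1\<close> modulo \<open>p\<close>.\<close>
  hence "p dvd (X + 4 - 3 * Y * c) * (X + 4 + 3 * Y * c) + p * (12 * p * Y^2)" by simp
  also have "(X + 4 - 3 * Y * c) * (X + 4 + 3 * Y * c) + p * (12 * p * Y^2)
      = (X + 4)^2 - 3 * Y^2 * (3 * c^2) + 12 * p^2 * Y^2"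
    by (simp add: power2_eq_square algebra_simps)
  also have "\<dots> = 8 * (X + 4)"
    unfolding c using XY by (simp add: power2_eq_square algebra_simps)
  finally have "p dvd 2^3 * (X + 4)" by simp
  hence "p dvd 2^3 \<or> p dvd X + 4" using p(1) prime_dvd_mult_iff by blast
  moreover have "\<not> p dvd 2^3"
  proof
    assume "p dvd 2^3"
    hence "p dvd 2" using p(1) prime_dvd_power by blast
    thus False using small[of 2] by simp
  qed
  ultimately have "p dvd X + 4" by blast
  hence "X = -4" by (rule eisenstein_unit_minus_1[OF p XY])
  moreover have "Y = 0" using XY \<open>X = -4\<close> by simp
  ultimately have "p^2 dvd 4 * (T + 1)" using T4' by simp
  moreover have "coprime (p^2) 4"
  proof -
    have "coprime p 2" using small[of 2] prime_imp_coprime[OF p(1), of 2] by simp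
    hence "coprime (p^2) (2^2)" unfolding coprime_power_left_iff coprime_power_right_iff by blast
    thus ?thesis by simp
  qed
  ultimately have "p^2 dvd T + 1" using coprime_dvd_mult_right_iff by blast
  thus ?thesis by (simp add: cong_iff_dvd_diff)
qed

section \<open>Power residues in a finite field\<close>

lemma unit_power_card_minus_1:
  fixes x :: "'a::finite_field"
  assumes "x \<noteq> 0"
  shows "x ^ (CARD('a) - 1) = 1"
proof -
  have "x * x ^ (CARD('a) - 1) = x * 1"
    using finite_field_power_card_eq_same[of x] power_Suc[of x "CARD('a) - 1"]
      finite_UNIV_card_ge_0[where ?'a = 'a] by simp
  thus ?thesis using assms by simp
qed

lemma card_power_eq_le:
  fixes c :: "'a::finite_field"
  assumes "n > 0"
  shows "card {x. x ^ n = c} \<le> n"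
proof -
  let ?P = "monom 1 n - [:c:]"
  have deg: "degree ?P = n"
    using assms by (subst diff_conv_add_uminus, subst degree_add_eq_left) (auto simp: degree_monom_eq)
  hence "?P \<noteq> 0" using assms by force
  from card_poly_roots_bound[OF this] deg show ?thesis by (simp add: poly_monom)
qed

lemma card_finite_field_gt_1: "CARD('a::finite_field) > 1"
  using card_mono[of UNIV "{0, 1 :: 'a}"] by simp

lemma ex_power_neq_1:
  assumes "0 < s" "s < CARD('a::finite_field) - 1"
  shows "\<exists>g :: 'a. g \<noteq> 0 \<and> g ^ s \<noteq> 1"
proof (rule ccontr)
  assume "\<not> ?thesis"
  hence "- {0} \<subseteq> {x :: 'a. x ^ s = 1}" by auto
  hence "card (- {0 :: 'a}) \<le> card {x :: 'a. x ^ s = 1}" by (intro card_mono) auto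
  also have "\<dots> \<le> s" using assms(1) by (rule card_power_eq_le)
  finally show False using assms(2) by (simp add: Compl_eq_Diff_UNIV)
qed

text \<open>A counting substitute for cyclicity of the multiplicative group. The nonzero \<open>n\<close>-th powers lie among the
  at most \<open>m\<close> roots of \<open>x ^ m = 1\<close>, and each is attained at most \<open>n\<close> times; since \<open>n * m\<close> elements are
  distributed, both bounds are equalities.\<close>
lemma power_residues:
  fixes n m :: nat and x y :: "'a::finite_field"
  assumes "CARD('a::finite_field) - 1 = n * m"
  shows card_power_residue_fibre: "y \<noteq> 0 \<Longrightarrow> card {x :: 'a. x ^ n = y ^ n} = n"
    and power_residue_iff: "x ^ m = 1 \<longleftrightarrow> (\<exists>y. y \<noteq> 0 \<and> x = y ^ n)"
    and card_roots_of_unity: "card {x :: 'a. x ^ m = 1} = m"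
proof -
  let ?U = "- {0} :: 'a set"
  have "n * m > 0" unfolding assms [symmetric] using card_finite_field_gt_1[where ?'a = 'a] by simp
  hence n: "n > 0" and m: "m > 0" by simp_all
  define S where "S = (\<lambda>y. y ^ n) ` ?U"
  define R where "R = {x :: 'a. x ^ m = 1}"
  have sub: "S \<subseteq> R"
    unfolding S_def R_def using unit_power_card_minus_1[where ?'a = 'a, unfolded assms]
    by (auto simp: power_mult [symmetric])
  have "card R \<le> m" unfolding R_def using m by (rule card_power_eq_le)
  have fib: "card {x \<in> ?U. x ^ n = s} \<le> n" for s
    using card_power_eq_le[OF n, of s] by (rule order_trans [rotated]) (auto intro: card_mono)
  have part: "n * m = (\<Sum>s\<in>S. card {x \<in> ?U. x ^ n = s})"
  proof -
    have "n * m = (\<Sum>x\<in>?U. 1)" using assms by (simp add: Compl_eq_Diff_UNIV)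
    also have "\<dots> = (\<Sum>s\<in>S. \<Sum>x\<in>{x \<in> ?U. x ^ n = s}. 1)"
      by (rule sum.group [symmetric]) (auto simp: S_def)
    finally show ?thesis by simp
  qed
  also have "\<dots> \<le> (\<Sum>s\<in>S. n)" by (intro sum_mono fib)
  finally have "m \<le> card S" using n by simp
  have SR: "S = R"
    using sub \<open>m \<le> card S\<close> \<open>card R \<le> m\<close> by (intro card_seteq) auto
  have cS: "card S = m"
    using \<open>m \<le> card S\<close> \<open>card R \<le> m\<close> unfolding SR by simp
  show "card {x :: 'a. x ^ m = 1} = m" using cS unfolding SR R_def .
  show "x ^ m = 1 \<longleftrightarrow> (\<exists>y. y \<noteq> 0 \<and> x = y ^ n)"
    using SR unfolding S_def R_def by auto
  show "card {x. x ^ n = y ^ n} = n" if "y \<noteq> 0"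
  proof -
    have "y ^ n \<in> S" using that by (auto simp: S_def)
    moreover have "(\<Sum>s\<in>S. card {x \<in> ?U. x ^ n = s}) = (\<Sum>s\<in>S. n)"
      unfolding part [symmetric] by (simp add: cS mult.commute)
    ultimately have "card {x \<in> ?U. x ^ n = y ^ n} = n"
      using sum_mono_inv[of "\<lambda>s. card {x \<in> ?U. x ^ n = s}" S "\<lambda>s. n"] fib by auto
    moreover have "z \<noteq> 0" if "z ^ n = y ^ n" for z
      using that \<open>y \<noteq> 0\<close> zero_power[OF n] power_not_zero[of y n] by metis
    hence "{x \<in> ?U. x ^ n = y ^ n} = {x. x ^ n = y ^ n}" by auto
    ultimately show ?thesis by simp
  qed
qed

section \<open>The quadratic character\<close>

definition quad_char :: "'a::finite_field \<Rightarrow> int" where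
  "quad_char x = (if x = 0 then 0 else if \<exists>y. x = y^2 then 1 else - 1)"

lemma quad_char_0 [simp]: "quad_char 0 = 0"
  by (simp add: quad_char_def)

lemma quad_char_range: "quad_char x \<in> {-1, 0, 1}"
  by (simp add: quad_char_def)

lemma quad_char_square: "x \<noteq> 0 \<Longrightarrow> quad_char x * quad_char x = 1"
  by (simp add: quad_char_def)

context
  assumes odd: "odd (CARD('a::finite_field))"
begin

lemma card_minus_1_halves: "CARD('a) - 1 = 2 * ((CARD('a) - 1) div 2)"
  using odd by simp

lemma two_neq_0: "(2 :: 'a) \<noteq> 0"
proof
  assume "(2 :: 'a) = 0"
  hence "of_nat 2 = (0 :: 'a)" by simp
  hence "CHAR('a) dvd 2" by (simp only: of_nat_eq_0_iff_char_dvd)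
  moreover have "prime CHAR('a)"
    using prime_CHAR_semidom[where ?'a = 'a] finite_imp_CHAR_pos[where ?'a = 'a] by simp
  ultimately have "CHAR('a) = 2" using primes_dvd_imp_eq two_is_prime_nat by blast
  thus False using odd CHAR_dvd_CARD[where ?'a = 'a] by simp
qed

text \<open>Euler's criterion: the squares exhaust the roots of \<open>x ^ ((q - 1) / 2) = 1\<close>. It yields multiplicativity of
  the character, as the field distinguishes \<open>-1\<close>, \<open>0\<close> and \<open>1\<close>, and later the value of character sums modulo
  the characteristic.\<close>
lemma of_int_quad_char: "of_int (quad_char x) = (x :: 'a) ^ ((CARD('a) - 1) div 2)"
proof (cases "x = 0")
  case True
  have "(CARD('a) - 1) div 2 > 0"
    using card_finite_field_gt_1[where ?'a = 'a] card_minus_1_halves by simp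
  thus ?thesis using True by simp
next
  case False
  let ?h = "(CARD('a) - 1) div 2"
  have "(x ^ ?h)^2 = 1"
    using unit_power_card_minus_1[OF False] card_minus_1_halves
    by (metis power_mult mult.commute)
  hence "x ^ ?h = 1 \<or> x ^ ?h = - 1" by (simp add: power2_eq_1_iff)
  moreover have "x ^ ?h = 1 \<longleftrightarrow> (\<exists>y. x = y^2)"
    using power_residue_iff[OF card_minus_1_halves, of x] False by (metis power_zero_numeral)
  moreover have "(1 :: 'a) \<noteq> - 1" using two_neq_0 by (metis add.right_inverse one_add_one)
  ultimately show ?thesis using False by (auto simp: quad_char_def)
qed

lemma of_int_sign_inject:
  assumes "of_int s = (of_int t :: 'a)" "s \<in> {-1, 0, 1}" "t \<in> {-1, 0, 1}"
  shows "s = t"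
proof -
  have "(1 :: 'a) \<noteq> - 1" using two_neq_0 by (metis add.right_inverse one_add_one)
  moreover have "(- 1 :: 'a) \<noteq> 1" using calculation by (rule not_sym)
  ultimately show ?thesis using assms by (elim insertE emptyE) simp_all
qed

lemma quad_char_mult: "quad_char (x * y :: 'a) = quad_char x * quad_char y"
proof (rule of_int_sign_inject)
  show "of_int (quad_char (x * y)) = (of_int (quad_char x * quad_char y) :: 'a)"
    by (simp only: of_int_quad_char of_int_mult power_mult_distrib)
  show "quad_char x * quad_char y \<in> {-1, 0, 1}"
    using quad_char_range[of x] quad_char_range[of y] by (elim insertE emptyE) simp_all
qed (rule quad_char_range)

lemma card_square_roots: "int (card {y :: 'a. y^2 = x}) = 1 + quad_char x"
proof -
  consider "x = 0" | y where "x = y^2" "y \<noteq> 0" | "x \<noteq> 0" "\<nexists>y. x = y^2" by force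
  thus ?thesis
  proof cases
    case 2
    thus ?thesis using card_power_residue_fibre[OF card_minus_1_halves] by (auto simp: quad_char_def)
  next
    case 3
    hence "{y :: 'a. y^2 = x} = {}" by auto
    thus ?thesis using 3 by (auto simp: quad_char_def)
  qed simp
qed

lemma sum_quad_char: "(\<Sum>x\<in>UNIV. quad_char (x :: 'a)) = 0"
proof -
  have "(\<Sum>x\<in>UNIV. 1 + quad_char (x :: 'a)) = (\<Sum>x\<in>UNIV. int (card {y :: 'a. y^2 = x}))"
    by (simp only: card_square_roots)
  also have "\<dots> = int (\<Sum>x\<in>(UNIV :: 'a set). card {y. y \<in> UNIV \<and> y^2 = x})"
    by (simp only: of_nat_sum UNIV_I simp_thms)
  also have "(\<Sum>x\<in>(UNIV :: 'a set). card {y. y \<in> UNIV \<and> y^2 = x}) = CARD('a)"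
    unfolding card_eq_sum by (rule sum.group[of UNIV UNIV "\<lambda>y. y^2" "\<lambda>_. 1"]) simp_all
  finally show ?thesis by (simp add: sum.distrib)
qed

text \<open>For \<open>a \<noteq> b\<close> the product at \<open>d\<close> is the character of the ratio of \<open>d + b\<close> to \<open>d + a\<close>, and that ratio
  takes every value except \<open>1\<close>.\<close>
lemma sum_quad_char_shift_mult:
  "(\<Sum>d\<in>UNIV. quad_char (d + a :: 'a) * quad_char (d + b))
   = (if a = b then int CARD('a) else 0) - 1"
proof (cases "a = b")
  case True
  have "(\<Sum>d\<in>UNIV. quad_char (d + a) * quad_char (d + b)) = (\<Sum>d\<in>UNIV. quad_char d * quad_char (d :: 'a))"
    unfolding True
    by (rule sum.reindex_bij_witness[of _ "\<lambda>d. d - b" "\<lambda>d. d + b"]) auto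
  also have "\<dots> = (\<Sum>d\<in>UNIV - {0 :: 'a}. 1)"
    by (rule sum.mono_neutral_cong_right) (auto simp: quad_char_square)
  also have "\<dots> = int CARD('a) - 1"
    using finite_UNIV_card_ge_0[where ?'a = 'a] by (simp add: of_nat_diff)
  finally show ?thesis using True by simp
next
  case False
  define c where "c = b - a"
  have c: "c \<noteq> 0" using False by (simp add: c_def)
  have "(\<Sum>d\<in>UNIV. quad_char (d + a) * quad_char (d + b)) = (\<Sum>d\<in>UNIV. quad_char d * quad_char (d + c))"
    by (rule sum.reindex_bij_witness[of _ "\<lambda>d. d - a" "\<lambda>d. d + a"]) (auto simp: c_def algebra_simps)
  also have "\<dots> = (\<Sum>d\<in>UNIV - {0}. quad_char d * quad_char (d + c))"
    by (rule sum.mono_neutral_right) auto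
  also have "\<dots> = (\<Sum>d\<in>UNIV - {0}. quad_char (1 + c / d))"
  proof (rule sum.cong)
    fix d assume "d \<in> UNIV - {0 :: 'a}"
    hence d: "d \<noteq> 0" by simp
    have "d + c = d * (1 + c / d)" using d by (simp add: field_simps)
    hence "quad_char d * quad_char (d + c) = (quad_char d * quad_char d) * quad_char (1 + c / d)"
      by (simp only: quad_char_mult mult.assoc)
    thus "quad_char d * quad_char (d + c) = quad_char (1 + c / d)"
      using d by (simp add: quad_char_square)
  qed simp
  also have "\<dots> = (\<Sum>t\<in>UNIV - {1 :: 'a}. quad_char t)"
    by (rule sum.reindex_bij_witness[of _ "\<lambda>t. c / (t - 1)" "\<lambda>d. 1 + c / d"])
       (use c in \<open>auto simp: field_simps\<close>)
  also have "\<dots> = (\<Sum>t\<in>(UNIV :: 'a set). quad_char t) - quad_char (1 :: 'a)"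
    by (simp add: sum_diff1)
  also have "quad_char (1 :: 'a) = 1"
    unfolding quad_char_def using power_one[of 2] by (metis one_neq_zero)
  finally show ?thesis using False by (simp add: sum_quad_char)
qed
end

section \<open>Character sums of the curves \<open>y^2 = x^3 + d\<close>\<close>

definition cubic_char_sum :: "'a::finite_field \<Rightarrow> int" where
  "cubic_char_sum d = (\<Sum>x\<in>UNIV. quad_char (x^3 + d))"

text \<open>The nonzero elements form three cosets of the cubes, told apart by the \<open>m\<close>-th power, which is a cube root
  of unity.\<close>
lemma cubic_class_sum:
  assumes q: "CARD('a::finite_field) - 1 = 3 * m"
  obtains g :: "'a::finite_field" where "g \<noteq> 0" and
    "\<And>F :: 'a::finite_field \<Rightarrow> int. (\<And>u d. u \<noteq> 0 \<Longrightarrow> F (u^3 * d) = F d) \<Longrightarrow>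
       (\<Sum>d\<in>-{0}. F d) = int m * (F 1 + F g + F (g^2))"
proof -
  have q': "CARD('a) - 1 = m * 3" using q by simp
  have m: "m > 0" using q card_finite_field_gt_1[where ?'a = 'a] by simp
  hence "\<exists>g :: 'a. g \<noteq> 0 \<and> g ^ m \<noteq> 1" using q by (intro ex_power_neq_1) simp_all
  then obtain g :: 'a where g: "g \<noteq> 0" "g ^ m \<noteq> 1" by blast
  define w where "w = g ^ m"
  have w3: "w^3 = 1" "w \<noteq> 1"
    using g unit_power_card_minus_1[OF g(1)] unfolding w_def q' by (simp_all add: power_mult)
  have w2: "w^2 \<noteq> 1"
  proof
    assume "w^2 = 1"
    moreover have "w^3 = w^2 * w" by (simp add: power2_eq_square power3_eq_cube)
    ultimately show False using w3 by simp
  qed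
  have "w^2 \<noteq> w" using w3(2) g(1) by (auto simp: power2_eq_square w_def)
  hence "card {1, w, w^2} = 3" using w3 w2 by auto
  moreover have "card {x :: 'a. x^3 = 1} = 3" by (rule card_roots_of_unity[OF q'])
  moreover have "(w^2)^3 = (w^3)^2" by (simp flip: power_mult)
  hence "{1, w, w^2} \<subseteq> {x. x^3 = 1}" using w3 by auto
  ultimately have roots: "{x. x^3 = 1} = {1, w, w^2}"
    using card_subset_eq[of "{x. x^3 = 1}" "{1, w, w^2}"] by simp
  have "(\<Sum>d\<in>-{0}. F d) = int m * (F 1 + F g + F (g^2))"
    if inv: "\<And>u d. u \<noteq> 0 \<Longrightarrow> F (u^3 * d) = F d" for F :: "'a \<Rightarrow> int"
  proof -
    have class_sum: "(\<Sum>d | d \<in> -{0} \<and> d ^ m = y ^ m. F d) = int m * F y" if y: "y \<noteq> 0" for y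
    proof -
      have "F d = F y" if "d \<noteq> 0" "d ^ m = y ^ m" for d
      proof -
        have "(d / y) ^ m = 1" using that y by (simp add: power_divide)
        then obtain u where "u \<noteq> 0" "d / y = u^3" using power_residue_iff[OF q] by blast
        thus ?thesis using inv[of u y] y by (simp add: field_simps)
      qed
      hence "(\<Sum>d | d \<in> -{0} \<and> d ^ m = y ^ m. F d) = (\<Sum>d | d \<in> -{0} \<and> d ^ m = y ^ m. F y)"
        by (intro sum.cong) auto
      moreover have "{d. d \<in> -{0} \<and> d ^ m = y ^ m} = {d. d ^ m = y ^ m}"
        using power_not_zero[OF y, of m] zero_power[OF m, where ?'a = 'a] by (auto simp del: power_eq_0_iff)
      ultimately show ?thesis using card_power_residue_fibre[OF q' y] by simp
    qed
    have "(\<lambda>d. d ^ m) ` (-{0 :: 'a}) \<subseteq> {x. x^3 = 1}"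
      using unit_power_card_minus_1[where ?'a = 'a, unfolded q'] by (auto simp: power_mult)
    hence "(\<Sum>d\<in>-{0}. F d) = (\<Sum>t\<in>{x. x^3 = 1}. \<Sum>d | d \<in> -{0} \<and> d ^ m = t. F d)"
      by (intro sum.group [symmetric]) auto
    also have "\<dots> = (\<Sum>d | d \<in> -{0} \<and> d ^ m = 1 ^ m. F d) + (\<Sum>d | d \<in> -{0} \<and> d ^ m = g ^ m. F d)
       + (\<Sum>d | d \<in> -{0} \<and> d ^ m = (g^2) ^ m. F d)"
      unfolding roots using w3 w2 \<open>w^2 \<noteq> w\<close> by (simp add: w_def power_mult [symmetric] mult.commute)
    also have "\<dots> = int m * F 1 + int m * F g + int m * F (g^2)"
      using g by (intro arg_cong2[where f = "(+)"] class_sum) auto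
    finally show ?thesis by (simp add: algebra_simps)
  qed
  with g(1) that show ?thesis by blast
qed

context
  fixes r :: nat
  assumes q: "CARD('a::finite_field) = 6 * r + 1"
begin

lemma sixth_pos: "r > 0"
  using q card_finite_field_gt_1[where ?'a = 'a] by simp

lemma odd_card: "odd CARD('a)"
  using q by simp

lemma card_minus_1_thirds: "CARD('a) - 1 = 3 * (2 * r)"
  using q by simp

lemma quad_char_cube: "quad_char (x^3 :: 'a) = quad_char x"
  using quad_char_square[of x] by (cases "x = 0") (simp_all add: power3_eq_cube quad_char_mult[OF odd_card])

lemma cubic_char_sum_cube_mult:
  fixes u d :: 'a
  assumes "u \<noteq> 0"
  shows "cubic_char_sum (u^3 * d) = quad_char u * cubic_char_sum d"
proof -
  have "cubic_char_sum (u^3 * d) = (\<Sum>x\<in>UNIV. quad_char (u^3 * (x^3 + d)))"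
    unfolding cubic_char_sum_def
    by (rule sum.reindex_bij_witness[of _ "\<lambda>x. u * x" "\<lambda>x. x / u"])
       (use assms in \<open>auto simp: algebra_simps power_divide power_mult_distrib\<close>)
  thus ?thesis
    by (simp add: quad_char_mult[OF odd_card] quad_char_cube cubic_char_sum_def sum_distrib_left)
qed

text \<open>The twist by \<open>quad_char d\<close> makes the summand constant on each coset of the cubes. The total
  vanishes because, after the exchange of the sums, \<open>x = 0\<close> contributes \<open>q - 1\<close> and each of the \<open>q - 1\<close>
  other values of \<open>x\<close> contributes \<open>-1\<close>.\<close>
lemma sum_cubic_char_sum_twisted:
  "(\<Sum>d\<in>-{0 :: 'a}. quad_char d * cubic_char_sum d) = 0"
proof -
  have "(\<Sum>d\<in>-{0 :: 'a}. quad_char d * cubic_char_sum d) = (\<Sum>d\<in>UNIV. quad_char d * cubic_char_sum (d :: 'a))"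
    by (rule sum.mono_neutral_left) auto
  also have "\<dots> = (\<Sum>d\<in>UNIV. \<Sum>x\<in>UNIV. quad_char (d + 0) * quad_char (d + x^3 :: 'a))"
    by (simp add: cubic_char_sum_def sum_distrib_left add.commute)
  also have "\<dots> = (\<Sum>x\<in>UNIV. \<Sum>d\<in>UNIV. quad_char (d + 0) * quad_char (d + x^3 :: 'a))"
    by (rule sum.swap)
  also have "\<dots> = (\<Sum>x\<in>UNIV. (if x = (0 :: 'a) then int CARD('a) else 0) - 1)"
    by (intro sum.cong refl) (simp only: sum_quad_char_shift_mult[OF odd_card], auto)
  also have "\<dots> = 0" by (simp add: sum_subtractf)
  finally show ?thesis .
qed

text \<open>Expanding the square, the sum over \<open>d\<close> detects the pairs \<open>(x, y)\<close> with equal cubes; there are three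
  choices of \<open>x\<close> for each \<open>y \<noteq> 0\<close>.\<close>
lemma sum_cubic_char_sum_square:
  "(\<Sum>d\<in>-{0 :: 'a}. (cubic_char_sum d)^2) = 12 * int r * int CARD('a)"
proof -
  have "cubic_char_sum (0 :: 'a) = 0"
    by (simp add: cubic_char_sum_def quad_char_cube sum_quad_char[OF odd_card])
  hence "(\<Sum>d\<in>-{0 :: 'a}. (cubic_char_sum d)^2) = (\<Sum>d\<in>UNIV. (cubic_char_sum (d :: 'a))^2)"
    by (intro sum.mono_neutral_left) auto
  also have "\<dots> = (\<Sum>d\<in>UNIV. \<Sum>y\<in>UNIV. \<Sum>x\<in>UNIV. quad_char (d + x^3) * quad_char (d + y^3 :: 'a))"
    by (simp add: cubic_char_sum_def power2_eq_square sum_product add.commute mult.commute)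
  also have "\<dots> = (\<Sum>y\<in>UNIV. \<Sum>x\<in>UNIV. \<Sum>d\<in>UNIV. quad_char (d + x^3) * quad_char (d + y^3 :: 'a))"
    by (subst sum.swap, rule sum.cong[OF refl], rule sum.swap)
  also have "\<dots> = (\<Sum>y\<in>UNIV. \<Sum>x\<in>UNIV. (if x^3 = (y^3 :: 'a) then int CARD('a) else 0) - 1)"
    by (simp only: sum_quad_char_shift_mult[OF odd_card])
  also have "\<dots> = (\<Sum>y\<in>UNIV. int CARD('a) * int (card {x. x^3 = (y^3 :: 'a)}) - int CARD('a))"
    by (intro sum.cong refl) (simp add: sum_subtractf sum.If_cases)
  also have "\<dots> = (\<Sum>y\<in>UNIV. 2 * int CARD('a) - (if y = (0 :: 'a) then 2 * int CARD('a) else 0))"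
  proof (intro sum.cong refl)
    fix y :: 'a
    show "int CARD('a) * int (card {x. x^3 = y^3}) - int CARD('a)
          = 2 * int CARD('a) - (if y = 0 then 2 * int CARD('a) else 0)"
      using card_power_residue_fibre[OF card_minus_1_thirds, of y] by simp
  qed
  also have "\<dots> = 2 * int CARD('a) * (int CARD('a) - 1)"
    by (simp add: sum_subtractf algebra_simps)
  also have "\<dots> = 12 * int r * int CARD('a)" by (simp add: q)
  finally show ?thesis .
qed

text \<open>Jacobsthal's argument. The twisted sums take three values, one for each coset of the cubes; the first moment
  gives their sum \<open>0\<close> and the second moment their sum of squares \<open>6 * q\<close>. If \<open>a\<close> and \<open>b\<close> are two of them,
  then \<open>a^2 + a * b + b^2 = 3 * q\<close>. Completing the square shows that \<open>4 * q\<close> is a square plus three times a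
  square, so the sum at \<open>-1\<close> is the trace of an Eisenstein integer of norm \<open>q\<close>.\<close>
lemma cubic_char_sum_norm:
  "\<exists>b. (cubic_char_sum (-1 :: 'a))^2 + 3 * b^2 = 4 * int CARD('a)"
proof -
  obtain g :: 'a where g: "g \<noteq> 0" and
    classes: "\<And>F :: 'a \<Rightarrow> int. (\<And>u d. u \<noteq> 0 \<Longrightarrow> F (u^3 * d) = F d) \<Longrightarrow>
       (\<Sum>d\<in>-{0}. F d) = int (2 * r) * (F 1 + F g + F (g^2))"
    using cubic_class_sum[OF card_minus_1_thirds] by blast
  define W where "W d = quad_char d * cubic_char_sum d" for d :: 'a
  have W_inv: "W (u^3 * d) = W d" if "u \<noteq> 0" for u d
    using quad_char_square[OF that]
    by (simp add: W_def cubic_char_sum_cube_mult[OF that] quad_char_mult[OF odd_card] quad_char_cube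
        mult.left_commute mult.assoc [symmetric])
  have W_sq: "(W d)^2 = (cubic_char_sum d)^2" if "d \<noteq> 0" for d
    using quad_char_square[OF that] by (simp add: W_def power_mult_distrib power2_eq_square)
  have "int (2 * r) * (W 1 + W g + W (g^2)) = (\<Sum>d\<in>-{0}. W d)"
    by (rule classes [symmetric]) (rule W_inv)
  also have "\<dots> = 0" unfolding W_def by (rule sum_cubic_char_sum_twisted)
  finally have s1: "W (g^2) = - W 1 - W g" using sixth_pos by simp
  have "int (2 * r) * ((W 1)^2 + (W g)^2 + (W (g^2))^2) = (\<Sum>d\<in>-{0}. (W d)^2)"
    by (rule classes [symmetric]) (simp add: W_inv)
  also have "\<dots> = (\<Sum>d\<in>-{0 :: 'a}. (cubic_char_sum d)^2)"
    by (intro sum.cong) (auto simp: W_sq)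
  also have "\<dots> = int (2 * r) * (6 * int CARD('a))" by (simp add: sum_cubic_char_sum_square)
  finally have "(W 1)^2 + (W g)^2 + (W (g^2))^2 = 6 * int CARD('a)" using sixth_pos by simp
  hence s2: "(W 1 + 2 * W g)^2 = 3 * (4 * int CARD('a) - (W 1)^2)"
    unfolding s1 by (simp add: power2_eq_square algebra_simps)
  hence "3 dvd (W 1 + 2 * W g)^2" by simp
  moreover have "prime (3 :: int)" by simp
  ultimately have "3 dvd W 1 + 2 * W g" by (rule prime_dvd_power [rotated])
  then obtain b where "W 1 + 2 * W g = 3 * b" by blast
  hence "(W 1)^2 + 3 * b^2 = 4 * int CARD('a)"
    using s2 by (simp add: power_mult_distrib)
  moreover have "(W 1)^2 = (cubic_char_sum (-1 :: 'a))^2"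
    using W_inv[of "-1" 1] W_sq[of "-1"] by simp
  ultimately show ?thesis by auto
qed

lemma sum_powers:
  "(\<Sum>x\<in>UNIV. x ^ j :: 'a) = (if j > 0 \<and> (CARD('a) - 1) dvd j then - 1 else 0)"
proof -
  have card0: "of_nat CARD('a) = (0 :: 'a)"
    using CHAR_dvd_CARD[where ?'a = 'a] by (simp only: of_nat_eq_0_iff_char_dvd)
  consider "j = 0" | t where "j = (CARD('a) - 1) * t" "j > 0" | "\<not> (CARD('a) - 1) dvd j" by blast
  thus ?thesis
  proof cases
    case 1
    thus ?thesis using card0 by simp
  next
    case (2 t)
    have "(\<Sum>x\<in>UNIV. x ^ j :: 'a) = (\<Sum>x\<in>UNIV - {0}. x ^ j)"
      by (rule sum.mono_neutral_right) (use 2 in auto)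
    also have "\<dots> = (\<Sum>x\<in>UNIV - {0 :: 'a}. 1)"
      unfolding 2(1) power_mult by (intro sum.cong refl) (simp add: unit_power_card_minus_1 [simplified])
    also have "\<dots> = of_nat (CARD('a) - 1)" by simp
    also have "\<dots> = - 1" using card0 q by (simp add: add_eq_0_iff)
    finally show ?thesis using 2 by simp
  next
    case 3
    define s where "s = j mod (CARD('a) - 1)"
    have s: "0 < s" "s < CARD('a) - 1" using 3 sixth_pos q by (auto simp: s_def mod_greater_zero_iff_not_dvd)
    obtain g :: 'a where g: "g \<noteq> 0" "g ^ s \<noteq> 1" using ex_power_neq_1[OF s] by blast
    have "g ^ j = g ^ ((CARD('a) - 1) * (j div (CARD('a) - 1)) + s)" by (simp only: s_def mult_div_mod_eq)
    hence "g ^ j = g ^ s"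
      by (simp only: power_add power_mult unit_power_card_minus_1[OF g(1)] power_one mult_1_left)
    hence gj: "g ^ j \<noteq> 1" using g(2) by simp
    have "(\<Sum>x\<in>UNIV. x ^ j) = (\<Sum>x\<in>UNIV. (g * x) ^ j)"
      by (rule sum.reindex_bij_witness[of _ "\<lambda>x. g * x" "\<lambda>x. x / g"]) (use g in auto)
    also have "\<dots> = g ^ j * (\<Sum>x\<in>UNIV. x ^ j)"
      by (simp add: power_mult_distrib sum_distrib_left)
    finally have "(1 - g ^ j) * (\<Sum>x\<in>UNIV. x ^ j) = 0" by (simp add: algebra_simps)
    thus ?thesis using gj 3 by simp
  qed
qed

text \<open>By Euler's criterion the sum reduces to the power sums of \<open>(x^3 - 1) ^ (3 * r)\<close>, and the only exponent in
  its expansion that is a positive multiple of \<open>q - 1 = 6 * r\<close> is \<open>6 * r\<close> itself.\<close>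
lemma of_int_cubic_char_sum:
  "of_int (cubic_char_sum (-1 :: 'a)) = (- of_nat ((3 * r) choose (2 * r)) * (- 1) ^ r :: 'a)"
proof -
  have h: "(CARD('a) - 1) div 2 = 3 * r" using q by simp
  let ?c = "\<lambda>k. of_nat ((3 * r) choose k) * (- 1) ^ (3 * r - k) :: 'a"
  have "of_int (cubic_char_sum (-1 :: 'a)) = (\<Sum>x\<in>UNIV. (x^3 + (- 1)) ^ (3 * r) :: 'a)"
    by (simp only: cubic_char_sum_def of_int_sum of_int_quad_char[OF odd_card] h)
  also have "\<dots> = (\<Sum>x\<in>UNIV. \<Sum>k\<le>3 * r. ?c k * x ^ (3 * k))"
    by (subst binomial_ring) (simp add: mult_ac flip: power_mult)
  also have "\<dots> = (\<Sum>k\<le>3 * r. ?c k * (\<Sum>x\<in>UNIV. x ^ (3 * k)))"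
    by (subst sum.swap) (simp only: sum_distrib_left)
  also have "\<dots> = (\<Sum>k\<in>{2 * r}. ?c k * (- 1))"
  proof (rule sum.mono_neutral_cong_right)
    have *: "3 * k > 0 \<and> (CARD('a) - 1) dvd 3 * k \<longleftrightarrow> k = 2 * r" if "k \<le> 3 * r" for k
    proof
      assume "3 * k > 0 \<and> (CARD('a) - 1) dvd 3 * k"
      then obtain t where t: "k = 2 * r * t" "k > 0" by (auto simp: q dvd_def)
      hence "2 * t \<le> 3" using that sixth_pos by simp
      moreover have "t \<noteq> 0" using t by auto
      ultimately have "t = 1" by linarith
      thus "k = 2 * r" using t by simp
    qed (use sixth_pos q in auto)
    show "\<forall>k\<in>{..3 * r} - {2 * r}. ?c k * (\<Sum>x\<in>UNIV. x ^ (3 * k)) = 0"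
      using * by (auto simp: sum_powers)
    show "\<And>k. k \<in> {2 * r} \<Longrightarrow> ?c k * (\<Sum>x\<in>UNIV. x ^ (3 * k)) = ?c k * (- 1)"
      using *[of "2 * r"] by (auto simp: sum_powers)
  qed auto
  finally show ?thesis by simp
qed

lemma card_points_Mordell:
  "int (card (insert Infinity {Affine x y | x y :: 'a. y^2 = x^3 - 1}))
   = int CARD('a) + 1 + cubic_char_sum (-1 :: 'a)"
proof -
  let ?A = "Sigma UNIV (\<lambda>x. {y :: 'a. y^2 = x^3 + (- 1)})"
  have "{Affine x y | x y :: 'a. y^2 = x^3 - 1} = (\<lambda>(x, y). Affine x y) ` ?A" by auto
  moreover have "card ((\<lambda>(x, y). Affine x y) ` ?A) = card ?A"
    by (rule card_image) (auto simp: inj_on_def)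
  moreover have "int (card ?A) = (\<Sum>x\<in>UNIV. int (card {y :: 'a. y^2 = x^3 + (- 1)}))"
    by simp
  moreover have "\<dots> = int CARD('a) + cubic_char_sum (-1 :: 'a)"
    by (simp only: card_square_roots[OF odd_card] sum.distrib cubic_char_sum_def) simp
  moreover have "finite {Affine x y | x y :: 'a. y^2 = x^3 - 1}"
    using calculation(1) by simp
  moreover have "Infinity \<notin> {Affine x y | x y :: 'a. y^2 = x^3 - 1}" by auto
  ultimately show ?thesis by (simp add: card_insert_if)
qed

end

text \<open>The sign \<open>(-1) ^ r\<close> with \<open>r = (q - 1) / 6\<close> disappears because \<open>q\<close> is an even power
  of \<open>p\<close>, hence \<open>1\<close> modulo \<open>8\<close>.\<close>
lemma cubic_char_sum_cong_minus_1:
  fixes p :: nat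
  assumes "prime p" "[p = 1] (mod 6)" "CARD('f::finite_field) = p ^ (p - 1)"
  shows "[cubic_char_sum (-1 :: 'f) = -1] (mod int p)"
proof -
  define r where "r = (CARD('f) - 1) div 6"
  have "[CARD('f) = 1] (mod 6)"
    unfolding assms(3) using cong_pow[OF assms(2), of "p - 1"] by simp
  hence q: "CARD('f) = 6 * r + 1"
    unfolding r_def cong_def by (simp, presburger)
  have "even r"
  proof -
    have "odd p" using assms(2) unfolding cong_def by presburger
    then obtain k where k: "p - 1 = 2 * k" by (elim oddE) simp
    obtain a where "p = 2 * a + 1" using \<open>odd p\<close> by (elim oddE)
    hence "p^2 = 4 * (a * (a + 1)) + 1" by (simp add: power2_eq_square algebra_simps)
    moreover have "even (a * (a + 1))" by simp
    then obtain e where "a * (a + 1) = 2 * e" by (rule evenE)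
    ultimately have "p^2 = 8 * e + 1" by (simp only:)
    hence "[p^2 = 1] (mod 8)" by (simp add: cong_def)
    hence "[CARD('f) = 1] (mod 8)"
      unfolding assms(3) k power_mult using cong_pow[of "p^2" 1 8 k] by simp
    thus ?thesis unfolding q cong_def by presburger
  qed
  have "CHAR('f) dvd p ^ (p - 1)" using CHAR_dvd_CARD[where ?'a = 'f] assms(3) by simp
  moreover have "prime CHAR('f)"
    using prime_CHAR_semidom[where ?'a = 'f] finite_imp_CHAR_pos[where ?'a = 'f] by simp
  ultimately have char: "CHAR('f) = p"
    using assms(1) prime_dvd_power primes_dvd_imp_eq by blast
  have "[(3 * r) choose (2 * r) = 1] (mod p)"
    using choose_half_third_cong_1[OF assms(1,2), of "p - 1"] q assms(3) by simp
  hence "of_nat ((3 * r) choose (2 * r)) = (of_nat 1 :: 'f)"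
    by (simp only: of_nat_eq_iff_cong_CHAR char)
  hence "of_int (cubic_char_sum (-1 :: 'f)) = (of_int (-1) :: 'f)"
    using of_int_cubic_char_sum[OF q] \<open>even r\<close> by simp
  thus ?thesis by (simp only: of_int_eq_iff_cong_CHAR char)
qed

section \<open>The number of points modulo \<open>p^2\<close>\<close>

theorem corollary5p2:
  fixes p q :: nat and n :: int
    and \<iota> :: "'k::finite_field \<Rightarrow> 'f::finite_field"
    and E :: "'k weierstrass"
  assumes "prime p" and "[p = 1] (mod 3)"
    and "q = p ^ (p - 1)"
    and "CARD('k) = p" and "CARD('f) = q" and "field_hom \<iota>"
    and "E = Weierstrass 0 0 0 0 (- 1)"
    and "(int p)^2 = 3 * n^2 + 3 * n + 1"
  shows "[card (points (base_change \<iota> E)) = 0] (mod p^2)"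
proof -
  define T where "T = cubic_char_sum (-1 :: 'f)"
  have card: "CARD('f) = p ^ (p - 1)" using assms(3,5) by simp
  have "odd (int p)"
  proof -
    have "odd ((int p)^2)" unfolding assms(8) by (simp add: power2_eq_square)
    thus ?thesis by simp
  qed
  hence odd: "odd p" by simp
  have mod6: "[p = 1] (mod 6)" using odd assms(2) unfolding cong_def by presburger
  have "p \<noteq> 1" using assms(1) by auto
  hence p: "p > 6" using mod6 unfolding cong_def by presburger
  obtain k where k: "p - 1 = 2 * k" using odd by (elim oddE) simp
  have q_pow: "int CARD('f) = ((int p)^2)^k"
    unfolding card k by (simp add: power_mult)
  have "[CARD('f) = 1] (mod 6)"
    unfolding card using cong_pow[OF mod6, of "p - 1"] by simp
  hence q6: "CARD('f) = 6 * (CARD('f) div 6) + 1"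
    unfolding cong_def by (simp, presburger)
  obtain b where "T^2 + 3 * b^2 = 4 * ((int p)^2)^k"
    using cubic_char_sum_norm[OF q6] unfolding T_def q_pow by blast
  moreover have "[T = -1] (mod int p)"
    unfolding T_def by (rule cubic_char_sum_cong_minus_1[OF assms(1) mod6 card])
  ultimately have T: "[T = -1] (mod (int p)^2)"
    using trace_cong_minus_1[of "int p" n k T b] assms(1,8) p k by simp
  have "(int p)^2 dvd int CARD('f)"
    unfolding q_pow using p k by (intro dvd_power) auto
  hence "[int CARD('f) + 1 + T = 0 + 1 + -1] (mod (int p)^2)"
    by (intro cong_add T cong_refl) (simp add: cong_0_iff)
  moreover have "int (card (points (base_change \<iota> E))) = int CARD('f) + 1 + T"
    unfolding assms(7) points_base_change_Mordell[OF assms(6)] T_def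
    by (rule card_points_Mordell[OF q6])
  ultimately have "[int (card (points (base_change \<iota> E))) = int 0] (mod int (p^2))" by simp
  thus ?thesis by (simp only: cong_int_iff)
qed

end
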